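(* Consider the planar two-dumbbell problem with nontrivial dumbbells, and its colinear non-overlapped relative equilibria, i.e. those with $\theta_1=\theta_2=0$ and $r>x_{11}\ell_1+x_{22}\ell_2$. For sufficiently low angular momenta $L\ge 0$ there are no such relative equilibria. However, there are an angular momentum $L_b>0$ and a radius $r_b>x_{11}\ell_1+x_{22}\ell_2$ such that, at $L=L_b$, two relative equilibria bifurcate at radius $r_b$; and for all angular momenta $L>L_b$ there are exactly two such relative equilibria.
   Context: Planar two-dumbbell problem: two dumbbells with total masses $M_1,M_2>0$, $M_1+M_2=1$, move in a plane under Newtonian gravity ($G=1$). Dumbbell $i$ consists of two point masses $M_ix_{i1}$, $M_ix_{i2}$ ($x_{i1}+x_{i2}=1$) joined by a massless rod of length $\ell_i$, with $\ell_1+\ell_2=1$. Nontrivial means $x_{ij}\in(0,1)$, $\ell_i>0$ and $r>0$. Let $\vec r$ be the vector from the center of mass of dumbbell 1 to that of dumbbell 2, $r=|\vec r|$, and $\theta_i$ the angle between $\vec r$ and the rod of dumbbell $i$. In a frame with first axis along $\vec r$ and origin at the system's center of mass, mass $j$ of dumbbell $i$ is at $$\vec r_{ij}=(-1)^iM_nr(1,0)+(-1)^jx_{ik}\ell_i(\cos\theta_i,\sin\theta_i),\qquad n\ne i,\ k\ne j,$$ with all indices in $\{1,2\}$. Let $d_{uv}=|\vec r_{1u}-\vec r_{2v}|$ and $B_1=\frac{x_{11}x_{12}}{M_2}\ell_1^2$, $B_2=\frac{x_{21}x_{22}}{M_1}\ell_2^2$. The (scaled by $\frac1{M_1M_2}$)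 amended potential for scalar angular momentum $L$ is $$V(r,\theta_1,\theta_2)=\frac{L^2}{2(r^2+B_1+B_2)}-\sum_{u,v\in\{1,2\}}\frac{x_{1u}x_{2v}}{d_{uv}}.$$ A relative equilibrium (RE) with angular momentum $L$ is a critical point $(r,\theta_1,\theta_2)$, $r>0$, of $V$. "Two RE bifurcate at $L=L_b$ at radius $r_b$" means that at $L=L_b$ there is an RE with radius $r_b$ from which two branches of RE, existing for $L>L_b$, emanate (their radii tend to $r_b$ as $L\downarrow L_b$). *)

theory Defs
  imports "HOL-Analysis.Analysis"
begin

text \<open>
  Dumbbells, and the two masses of each dumbbell, are numbered 1 and 2: \<open>M i\<close> is the total mass of
  dumbbell \<open>i\<close>, \<open>l i\<close> the length of its rod and \<open>x i j\<close> the fraction of \<open>M i\<close> carried by its mass \<open>j\<close>.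
  Values at indices other than 1 and 2 are never used. For \<open>i\<close> in {1, 2} the other index is \<open>3 - i\<close>.
\<close>

definition nontrivial_dumbbells ::
  "(nat \<Rightarrow> real) \<Rightarrow> (nat \<Rightarrow> nat \<Rightarrow> real) \<Rightarrow> (nat \<Rightarrow> real) \<Rightarrow> bool" where
  "nontrivial_dumbbells M x l \<longleftrightarrow>
     (\<forall>i\<in>{1,2}. 0 < M i) \<and> M 1 + M 2 = 1 \<and>
     (\<forall>i\<in>{1,2}. \<forall>j\<in>{1,2}. 0 < x i j \<and> x i j < 1) \<and> (\<forall>i\<in>{1,2}. x i 1 + x i 2 = 1) \<and>
     (\<forall>i\<in>{1,2}. 0 < l i) \<and> l 1 + l 2 = 1"

definition mass_pos ::
  "(nat \<Rightarrow> real) \<Rightarrow> (nat \<Rightarrow> nat \<Rightarrow> real) \<Rightarrow> (nat \<Rightarrow> real) \<Rightarrow> nat \<Rightarrow> nat \<Rightarrow> real \<Rightarrow> real \<Rightarrow> real \<times> real" where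
  "mass_pos M x l i j r \<theta> =
     ((-1) ^ i * M (3 - i) * r) *\<^sub>R (1, 0) + ((-1) ^ j * x i (3 - j) * l i) *\<^sub>R (cos \<theta>, sin \<theta>)"

text \<open>The product metric on \<open>real \<times> real\<close> is the Euclidean one.\<close>

definition mass_dist ::
  "(nat \<Rightarrow> real) \<Rightarrow> (nat \<Rightarrow> nat \<Rightarrow> real) \<Rightarrow> (nat \<Rightarrow> real) \<Rightarrow> nat \<Rightarrow> nat \<Rightarrow> real \<times> real \<times> real \<Rightarrow> real" where
  "mass_dist M x l u v = (\<lambda>(r, \<theta>1, \<theta>2). dist (mass_pos M x l 1 u r \<theta>1) (mass_pos M x l 2 v r \<theta>2))"

definition inertia_const ::
  "(nat \<Rightarrow> real) \<Rightarrow> (nat \<Rightarrow> nat \<Rightarrow> real) \<Rightarrow> (nat \<Rightarrow> real) \<Rightarrow> nat \<Rightarrow> real" where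
  "inertia_const M x l i = x i 1 * x i 2 / M (3 - i) * (l i)\<^sup>2"

definition amended_potential ::
  "(nat \<Rightarrow> real) \<Rightarrow> (nat \<Rightarrow> nat \<Rightarrow> real) \<Rightarrow> (nat \<Rightarrow> real) \<Rightarrow> real \<Rightarrow> real \<times> real \<times> real \<Rightarrow> real" where
  "amended_potential M x l L q =
     L\<^sup>2 / (2 * ((fst q)\<^sup>2 + inertia_const M x l 1 + inertia_const M x l 2))
     - (\<Sum>u\<in>{1,2}. \<Sum>v\<in>{1,2}. x 1 u * x 2 v / mass_dist M x l u v q)"

text \<open>
  Configurations with a collision lie outside the domain of the potential and are excluded
  explicitly, since division by zero is total here.
\<close>

definition relative_equilibrium ::
  "(nat \<Rightarrow> real) \<Rightarrow> (nat \<Rightarrow> nat \<Rightarrow> real) \<Rightarrow> (nat \<Rightarrow> real) \<Rightarrow> real \<Rightarrow> real \<times> real \<times> real \<Rightarrow> bool" where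
  "relative_equilibrium M x l L q \<longleftrightarrow>
     0 < fst q \<and> (\<forall>u\<in>{1,2}. \<forall>v\<in>{1,2}. mass_dist M x l u v q \<noteq> 0) \<and>
     (amended_potential M x l L has_derivative (\<lambda>_. 0)) (at q)"

definition colinear_nonoverlapped_RE ::
  "(nat \<Rightarrow> real) \<Rightarrow> (nat \<Rightarrow> nat \<Rightarrow> real) \<Rightarrow> (nat \<Rightarrow> real) \<Rightarrow> real \<Rightarrow> (real \<times> real \<times> real) set" where
  "colinear_nonoverlapped_RE M x l L =
     {(r, \<theta>1, \<theta>2). relative_equilibrium M x l L (r, \<theta>1, \<theta>2) \<and>
        \<theta>1 = 0 \<and> \<theta>2 = 0 \<and> x 1 1 * l 1 + x 2 2 * l 2 < r}"

text \<open>
  \<open>S L\<close> is the set of equilibria under consideration at angular momentum \<open>L\<close>, and \<open>p\<close> is the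
  equilibrium with radius \<open>rb\<close> from which the two branches \<open>\<gamma>1\<close> and \<open>\<gamma>2\<close> emanate.
\<close>

definition two_RE_bifurcate ::
  "(real \<Rightarrow> (real \<times> real \<times> real) set) \<Rightarrow> real \<Rightarrow> real \<Rightarrow> bool" where
  "two_RE_bifurcate S Lb rb \<longleftrightarrow>
     (\<exists>p \<gamma>1 \<gamma>2. p \<in> S Lb \<and> fst p = rb \<and>
        continuous_on {Lb<..} \<gamma>1 \<and> continuous_on {Lb<..} \<gamma>2 \<and>
        (\<forall>L>Lb. \<gamma>1 L \<in> S L \<and> \<gamma>2 L \<in> S L \<and> \<gamma>1 L \<noteq> \<gamma>2 L) \<and>
        (\<gamma>1 \<longlongrightarrow> p) (at_right Lb) \<and> (\<gamma>2 \<longlongrightarrow> p) (at_right Lb))"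

end

theory Submission
  imports Defs "HOL-Real_Asymp.Real_Asymp"
begin

text \<open>
  At a colinear configuration the angular derivatives of the potential vanish by symmetry, and the
  distances are \<open>r + a\<close> with constants \<open>a\<close> depending on the pair of masses. The radial equation
  then reads \<open>L\<^sup>2 = F r\<close>, where \<open>F\<close> is a positive combination of the functions
  \<open>(r\<^sup>2 + B)\<^sup>2 / (r (r + a)\<^sup>2)\<close> and \<open>B = B\<^sub>1 + B\<^sub>2\<close>. Each of these is strictly convex,
  whatever the sign of \<open>a\<close>, and \<open>F\<close> tends to infinity both at the collision radius (where
  \<open>r + a\<close> vanishes for the two inner masses) and at infinity. So \<open>F\<close> has a unique minimum,
  attained at the bifurcation radius, and the two branches are the inverses of \<open>F\<close> on either side of it.
\<close>

section \<open>Distances between masses near a colinear configuration\<close>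

text \<open>Cosine is stationary at zero and the transverse component enters squared, so neither
  angle contributes to first order. Positivity of \<open>r + \<beta> - \<alpha>\<close> keeps the
  argument of \<open>sqrt\<close> away from zero and makes the radial slope
  \<open>+1\<close>.\<close>

lemma has_derivative_planar_dist_at_colinear:
  fixes r \<alpha> \<beta> :: real
  assumes "0 < r + \<beta> - \<alpha>"
  shows "((\<lambda>q :: real \<times> real \<times> real.
            sqrt ((fst q + \<beta> * cos (snd (snd q)) - \<alpha> * cos (fst (snd q)))\<^sup>2
                  + (\<beta> * sin (snd (snd q)) - \<alpha> * sin (fst (snd q)))\<^sup>2))
          has_derivative fst) (at (r, 0, 0))"
proof -
  let ?p = "\<lambda>q :: real \<times> real \<times> real.
              (fst q + \<beta> * cos (snd (snd q)) - \<alpha> * cos (fst (snd q)))\<^sup>2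
              + (\<beta> * sin (snd (snd q)) - \<alpha> * sin (fst (snd q)))\<^sup>2"
  have p: "(?p has_derivative (\<lambda>h. 2 * (r + \<beta> - \<alpha>) * fst h)) (at (r, 0, 0))"
    by (rule has_derivative_eq_rhs)
      (auto intro!: derivative_eq_intros simp: fun_eq_iff algebra_simps)
  have "(sqrt has_real_derivative inverse (r + \<beta> - \<alpha>) / 2) (at (?p (r, 0, 0)))"
    using DERIV_real_sqrt[of "(r + \<beta> - \<alpha>)\<^sup>2"] assms by simp
  from DERIV_compose_FDERIV[where g = ?p and x = "(r, 0, 0)", OF this p] show ?thesis
    by (rule has_derivative_eq_rhs) (use assms in \<open>simp add: fun_eq_iff divide_simps\<close>)
qed

section \<open>The contribution of one pair of masses to \<open>L^2\<close>\<close>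

text \<open>This solves the balance \<open>L^2 * r / (r^2 + B)^2 = 1 / (r + a)^2\<close> between the
  centrifugal term and the attraction at distance \<open>r + a\<close> for
  \<open>L^2\<close>.\<close>

definition ang_mom_term :: "real \<Rightarrow> real \<Rightarrow> real \<Rightarrow> real" where
  "ang_mom_term B a r = (r\<^sup>2 + B)\<^sup>2 / (r * (r + a)\<^sup>2)"

text \<open>The quotient rule, with one common factor \<open>r + a\<close> cancelled.\<close>

definition ang_mom_term_deriv :: "real \<Rightarrow> real \<Rightarrow> real \<Rightarrow> real" where
  "ang_mom_term_deriv B a r = (4 * r * (r\<^sup>2 + B) * r * (r + a) - (r\<^sup>2 + B)\<^sup>2 * (3 * r + a)) / (r\<^sup>2 * (r + a) ^ 3)"

lemma DERIV_ang_mom_term: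
  assumes "0 < r" "0 < r + a"
  shows "(ang_mom_term B a has_real_derivative ang_mom_term_deriv B a r) (at r)"
  unfolding ang_mom_term_def ang_mom_term_deriv_def using assms
  apply (auto intro!: derivative_eq_intros)
  apply (simp add: divide_simps)
  apply (simp add: algebra_simps power2_eq_square power3_eq_cube)
  done

lemma ang_mom_term_convex:
  assumes "0 < B" "0 < r" "0 < r + a"
  shows "\<exists>d>0. (ang_mom_term_deriv B a has_real_derivative d) (at r)"
proof -
  \<comment> \<open>the numerator of the second derivative, written as a sum of nonnegative terms\<close>
  let ?d = "(r\<^sup>2 * (2 * a\<^sup>2 * r\<^sup>2 + 4 * (a * r - B)\<^sup>2) + 4 * B * r ^ 4 + 2 * B\<^sup>2 * (a + 2 * r)\<^sup>2)
              / (r ^ 3 * (r + a) ^ 4)"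
  have "?d > 0" using assms
    by (intro divide_pos_pos add_nonneg_pos add_pos_nonneg mult_pos_pos) auto
  moreover have "(ang_mom_term_deriv B a has_real_derivative ?d) (at r)"
    unfolding ang_mom_term_deriv_def using assms
    apply (auto intro!: derivative_eq_intros)
    apply (simp add: divide_simps)
    apply algebra
    done
  ultimately show ?thesis by blast
qed

text \<open>Strict convexity is used in this form because it passes to sums with positive weights
  and fixes the sign of the derivative on both sides of a critical point.\<close>

lemma ang_mom_term_deriv_strict_mono:
  assumes "0 < B" "0 < r" "0 < r + a" "r < r'"
  shows "ang_mom_term_deriv B a r < ang_mom_term_deriv B a r'"
proof (rule DERIV_pos_imp_increasing[OF \<open>r < r'\<close>])
  fix t assume "r \<le> t" "t \<le> r'"
  then have "0 < t" "0 < t + a" using assms by auto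
  then show "\<exists>d. (ang_mom_term_deriv B a has_real_derivative d) (at t) \<and> 0 < d"
    using ang_mom_term_convex[OF \<open>0 < B\<close>] by blast
qed

text \<open>The numerator has degree four and the denominator degree three.\<close>

lemma ang_mom_term_at_top: "filterlim (ang_mom_term B a) at_top at_top"
  unfolding ang_mom_term_def by real_asymp

text \<open>Negative \<open>a\<close> puts the singularity at a positive radius, where
  \<open>(r^2 + B)^2 / r\<close> has a positive limit while \<open>(r + a)^2\<close> tends to zero
  from above.\<close>

lemma ang_mom_term_at_singularity:
  assumes "0 < B" "a < 0"
  shows "filterlim (ang_mom_term B a) at_top (at_right (- a))"
proof -
  have "filterlim (\<lambda>r. ((r\<^sup>2 + B)\<^sup>2 / r) / (r + a)\<^sup>2) at_top (at_right (- a))"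
  proof (rule LIM_at_top_divide)
    show "((\<lambda>r. (r\<^sup>2 + B)\<^sup>2 / r) \<longlongrightarrow> (a\<^sup>2 + B)\<^sup>2 / (- a)) (at_right (- a))"
      using \<open>a < 0\<close> by (auto intro!: tendsto_eq_intros)
    have "0 < a\<^sup>2 + B" using \<open>0 < B\<close> by (simp add: add_nonneg_pos)
    then show "0 < (a\<^sup>2 + B)\<^sup>2 / (- a)"
      using \<open>a < 0\<close> by (intro divide_pos_pos) auto
    show "((\<lambda>r. (r + a)\<^sup>2) \<longlongrightarrow> 0) (at_right (- a))"
      by (auto intro!: tendsto_eq_intros)
    show "eventually (\<lambda>r. 0 < (r + a)\<^sup>2) (at_right (- a))"
      by (auto simp: eventually_at_right_field intro!: exI[of _ "1 - a"])
  qed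
  then show ?thesis by (simp add: ang_mom_term_def[abs_def])
qed

section \<open>U-shaped functions and their inverse branches\<close>

text \<open>Divergence at both ends confines the search for a minimum to a compact interval. The
  derivative vanishes at the minimum \<open>c\<close>, and its strict growth then fixes its sign on
  either side.\<close>

lemma U_shaped_of_deriv_strict_mono:
  fixes F F' :: "real \<Rightarrow> real" and m :: real
  assumes deriv: "\<And>r. m < r \<Longrightarrow> (F has_real_derivative F' r) (at r)"
    and mono: "\<And>r r'. m < r \<Longrightarrow> r < r' \<Longrightarrow> F' r < F' r'"
    and left: "filterlim F at_top (at_right m)"
    and right: "filterlim F at_top at_top"
  obtains c where "m < c" "strict_antimono_on {m<..c} F" "strict_mono_on {c..} F"
proof -
  \<comment> \<open>The point \<open>m + 1\<close> is an arbitrary reference; its value is a level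
    that \<open>F\<close> exceeds near \<open>m\<close> and for all large arguments.\<close>
  have "eventually (\<lambda>r. F (m + 1) < F r) (at_right m)"
    using left unfolding filterlim_at_top_dense by blast
  then obtain u where u: "m < u" "\<And>r. m < r \<Longrightarrow> r < u \<Longrightarrow> F (m + 1) < F r"
    by (auto simp: eventually_at_right_field)
  have "eventually (\<lambda>r. F (m + 1) < F r) at_top"
    using right unfolding filterlim_at_top_dense by blast
  then obtain v where v: "\<And>r. v \<le> r \<Longrightarrow> F (m + 1) < F r"
    by (auto simp: eventually_at_top_linorder)
  \<comment> \<open>Lying below both \<open>u\<close> and \<open>m + 1\<close>, \<open>s\<close>
    leaves the reference point inside \<open>{s..v}\<close>, while \<open>F\<close> exceeds the
    level everywhere between \<open>m\<close> and \<open>s\<close>.\<close>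
  define s where "s = (m + min u (m + 1)) / 2"
  have s: "m < s" "s < u" "s < m + 1" using u by (auto simp: s_def min_def field_simps)
  have v': "m + 1 < v" using v[of "m + 1"] by fastforce
  have "continuous_on {s..v} F"
    using deriv s by (intro DERIV_continuous_on[where D = F']) (auto intro: has_field_derivative_at_within)
  then obtain c where c: "c \<in> {s..v}" "\<And>r. r \<in> {s..v} \<Longrightarrow> F c \<le> F r"
    using continuous_attains_inf[of "{s..v}" F] s v' by auto
  have "F c \<le> F (m + 1)" using c(2)[of "m + 1"] s v' by auto
  then have min: "F c \<le> F r" if "m < r" for r
    using that c(2)[of r] u(2)[of r] v[of r] s by (cases "r < s"; cases "v < r") force+
  have mc: "m < c" using c s by auto
  \<comment> \<open>The neighbourhood of radius \<open>c - m\<close> around \<open>c\<close> stays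
    to the right of \<open>m\<close>.\<close>
  have "F' c = 0"
    using DERIV_local_min[OF deriv[OF mc], of "c - m"] min mc by (auto simp: abs_less_iff)
  then have neg: "F' r < 0" if "m < r" "r < c" for r using mono[of r c] that by auto
  have pos: "0 < F' r" if "c < r" for r using mono[of c r] that mc \<open>F' c = 0\<close> by auto
  \<comment> \<open>The derivative has a strict sign only away from \<open>c\<close>. Continuity on
    closed intervals lets the monotonicity criteria for open intervals include \<open>c\<close> in
    both pieces.\<close>
  have cont: "continuous_on {p..q} F" if "m < p" for p q
    using deriv that by (intro DERIV_continuous_on[where D = F']) (auto intro: has_field_derivative_at_within)
  have deriv': "\<exists>y. (F has_real_derivative y) (at r) \<and> y < 0" if "m < r" "r < c" for r
    using deriv neg that by blast
  have deriv'': "\<exists>y. (F has_real_derivative y) (at r) \<and> y > 0" if "c < r" for r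
    using deriv[of r] pos[of r] that mc by auto
  have "strict_antimono_on {m<..c} F"
  proof (rule monotone_onI)
    fix p q assume "p \<in> {m<..c}" "q \<in> {m<..c}" "p < q"
    then have "m < p" "q \<le> c" by simp_all
    show "F p > F q"
    proof (rule DERIV_neg_imp_decreasing_open[OF \<open>p < q\<close>])
      show "\<exists>y. (F has_real_derivative y) (at t) \<and> y < 0" if "p < t" "t < q" for t
        using that \<open>m < p\<close> \<open>q \<le> c\<close> by (intro deriv') linarith+
    qed (rule cont[OF \<open>m < p\<close>])
  qed
  moreover have "strict_mono_on {c..} F"
  proof (rule monotone_onI)
    fix p q assume "p \<in> {c..}" "q \<in> {c..}" "p < q"
    then have "c \<le> p" "m < p" using mc by simp_all
    show "F p < F q"
    proof (rule DERIV_pos_imp_increasing_open[OF \<open>p < q\<close>])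
      show "\<exists>y. (F has_real_derivative y) (at t) \<and> y > 0" if "p < t" "t < q" for t
        using that \<open>c \<le> p\<close> by (intro deriv'') linarith
    qed (rule cont[OF \<open>m < p\<close>])
  qed
  ultimately show thesis using that mc by blast
qed

text \<open>By the intermediate value theorem \<open>f\<close> takes every value above
  \<open>f a\<close>, so its inverse is defined there. The interval is left general so that the
  lemma serves an unbounded right piece as well as a reflected, bounded left piece.\<close>

lemma strict_mono_on_inverse_branch:
  fixes f :: "real \<Rightarrow> real" and a :: real
  assumes I: "is_interval I" "a \<in> I" "\<And>t. t \<in> I \<Longrightarrow> a \<le> t" "open (I - {a})"
    and cont: "continuous_on I f" and mono: "strict_mono_on I f"
    and unbounded: "\<And>y. \<exists>t\<in>I. y < f t"
  obtains g where "continuous_on {f a<..} g" "\<And>y. f a < y \<Longrightarrow> g y \<in> I - {a} \<and> f (g y) = y"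
    "(g \<longlongrightarrow> a) (at_right (f a))"
proof -
  define g where "g = inv_into I f"
  have inj: "inj_on f I" using mono by (rule strict_mono_on_imp_inj_on)
  have less_iff: "f s < f t \<longleftrightarrow> s < t" if "s \<in> I" "t \<in> I" for s t
    using strict_mono_on_less[OF mono] that by blast
  have between: "t \<in> I" if "a \<le> t" "t \<le> s" "s \<in> I" for s t
    using I(1,2) that unfolding is_interval_1 by blast
  have "y \<in> f ` I" if y: "f a < y" for y
  proof -
    obtain s where s: "s \<in> I" "y < f s" using unbounded by blast
    have "a \<le> s" "{a..s} \<subseteq> I" using s I(3) between by auto
    then obtain t where "a \<le> t" "t \<le> s" "f t = y"
      using IVT'[of f a y s] s y continuous_on_subset[OF cont, of "{a..s}"] by auto
    then show ?thesis using \<open>{a..s} \<subseteq> I\<close> by auto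
  qed
  then have g: "g y \<in> I" "f (g y) = y" if "f a < y" for y
    using that unfolding g_def by (auto intro: inv_into_into f_inv_into_f)
  have ga: "a < g y" if "f a < y" for y
    using g[OF that] that I(2) less_iff[of a "g y"] by auto
  have image: "g ` {f a<..} = I - {a}"
  proof (intro equalityI subsetI)
    fix t assume t: "t \<in> I - {a}"
    then have "a < t" using I(3)[of t] by auto
    then have "f a < f t" using less_iff[of a t] t I(2) by auto
    moreover have "g (f t) = t" unfolding g_def using t inj by (auto intro: inv_into_f_f)
    ultimately show "t \<in> g ` {f a<..}" by (metis greaterThan_iff imageI)
  qed (use g ga in force)
  \<comment> \<open>A monotone function with open image cannot jump; this is where openness of
    \<open>I - {a}\<close> enters.\<close>
  have "continuous_on {f a<..} g"
  proof (rule continuous_onI_mono)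
    fix y z assume "y \<in> {f a<..}" "z \<in> {f a<..}" "y \<le> z"
    then show "g y \<le> g z" using g[of y] g[of z] less_iff[of "g z" "g y"] by fastforce
  qed (use image I(4) in simp)
  moreover have "(g \<longlongrightarrow> a) (at_right (f a))"
  proof (rule order_tendstoI)
    fix b assume "b < a"
    then show "eventually (\<lambda>y. b < g y) (at_right (f a))"
      using ga by (auto simp: eventually_at_right_field intro!: exI[of _ "f a + 1"] dest: less_trans)
  next
    fix b assume "a < b"
    obtain s where s: "s \<in> I" "f a < f s" using unbounded by blast
    \<comment> \<open>The bound \<open>b\<close> may lie outside \<open>I\<close>; the minimum with
      \<open>s\<close> stays inside and still exceeds \<open>a\<close>.\<close>
    define t where "t = min s b"
    have "a < s" using s I(2) less_iff by blast
    then have t: "t \<in> I" "a < t" "t \<le> b" using \<open>a < b\<close> s between[of t s] by (auto simp: t_def)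
    then have "f a < f t" using less_iff I(2) by blast
    moreover have "g y < b" if "f a < y" "y < f t" for y
      using g[OF that(1)] that t less_iff[of "g y" t] by auto
    ultimately show "eventually (\<lambda>y. g y < b) (at_right (f a))"
      by (auto simp: eventually_at_right_field)
  qed
  ultimately show thesis using that g ga by (metis Diff_iff less_irrefl singletonD)
qed

text \<open>Each monotone piece is inverted separately; injectivity on each piece excludes further
  solutions.\<close>

lemma U_shaped_inverse_branches:
  fixes F :: "real \<Rightarrow> real" and m c :: real
  assumes "m < c" and anti: "strict_antimono_on {m<..c} F" and mono: "strict_mono_on {c..} F"
    and cont: "continuous_on {m<..} F"
    and left: "filterlim F at_top (at_right m)"
    and right: "filterlim F at_top at_top"
  obtains g1 g2 where
    "continuous_on {F c<..} g1" "(g1 \<longlongrightarrow> c) (at_right (F c))"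
    "continuous_on {F c<..} g2" "(g2 \<longlongrightarrow> c) (at_right (F c))"
    "\<And>y. F c < y \<Longrightarrow> g1 y < g2 y \<and> {r. m < r \<and> F r = y} = {g1 y, g2 y}"
proof -
  obtain g2 where g2: "continuous_on {F c<..} g2" "\<And>y. F c < y \<Longrightarrow> g2 y \<in> {c..} - {c} \<and> F (g2 y) = y"
    "(g2 \<longlongrightarrow> c) (at_right (F c))"
  proof (rule strict_mono_on_inverse_branch[of "{c..}" c F])
    show "\<exists>t\<in>{c..}. y < F t" for y
    proof -
      have "eventually (\<lambda>t. y < F t \<and> c \<le> t) at_top"
        using right unfolding filterlim_at_top_dense by (intro eventually_conj eventually_ge_at_top) blast
      then show ?thesis using eventually_happens'[OF trivial_limit_at_top_linorder] by fastforce
    qed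
    show "continuous_on {c..} F"
      using \<open>m < c\<close> by (intro continuous_on_subset[OF cont]) auto
    have "{c..} - {c} = {c<..}" by auto
    then show "open ({c..} - {c})" by simp
  qed (use mono in \<open>auto simp: is_interval_1\<close>)
  \<comment> \<open>Reflection makes the decreasing piece increasing with least argument
    \<open>- c\<close>, so the same inversion lemma applies; the left branch is then
    \<open>- h\<close>.\<close>
  let ?I = "{- c..<- m}" and ?f = "\<lambda>t. F (- t)"
  obtain h where h: "continuous_on {F c<..} h" "\<And>y. F c < y \<Longrightarrow> h y \<in> ?I - {- c} \<and> F (- h y) = y"
    "(h \<longlongrightarrow> - c) (at_right (F c))"
  proof (rule strict_mono_on_inverse_branch[of ?I "- c" ?f])
    show "strict_mono_on ?I ?f"
      using anti by (auto simp: monotone_on_def)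
    show "continuous_on ?I ?f"
      by (rule continuous_on_compose2[OF cont]) (auto intro!: continuous_intros)
    have "?I - {- c} = {- c<..<- m}" by auto
    then show "open (?I - {- c})" by simp
    show "\<exists>t\<in>?I. y < ?f t" for y
    proof -
      have "eventually (\<lambda>t. y < F t \<and> t \<in> {m<..<c}) (at_right m)"
        using left unfolding filterlim_at_top_dense
        by (intro eventually_conj eventually_at_right_real[OF \<open>m < c\<close>]) blast
      then obtain t where "y < F t" "t \<in> {m<..<c}"
        using eventually_happens'[OF trivial_limit_at_right_real] by blast
      then show ?thesis by (intro bexI[of _ "- t"]) auto
    qed
  qed (use \<open>m < c\<close> in \<open>auto simp: is_interval_1\<close>)
  have "inj_on F {m<..c}"
    using monotone_onD[OF anti] by (intro linorder_inj_onI') fastforce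
  have "inj_on F {c..}" using mono by (rule strict_mono_on_imp_inj_on)
  show thesis
  proof (rule that[of "\<lambda>y. - h y" g2])
    show "((\<lambda>y. - h y) \<longlongrightarrow> c) (at_right (F c))" using tendsto_minus[OF h(3)] by simp
    fix y assume y: "F c < y"
    have "r = - h y \<or> r = g2 y" if "m < r" "F r = y" for r
    proof (cases "r \<le> c")
      case True
      have "r = - h y"
        by (rule inj_onD[OF \<open>inj_on F {m<..c}\<close>]) (use True that h(2)[OF y] in auto)
      then show ?thesis ..
    next
      case False
      have "r = g2 y"
        by (rule inj_onD[OF \<open>inj_on F {c..}\<close>]) (use False that g2(2)[OF y] in auto)
      then show ?thesis ..
    qed
    then show "- h y < g2 y \<and> {r. m < r \<and> F r = y} = {- h y, g2 y}"
      using h(2)[OF y] g2(2)[OF y] \<open>m < c\<close> by auto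
  qed (use g2(1,3) continuous_on_minus[OF h(1)] in simp_all)
qed

section \<open>The radial equation for colinear configurations\<close>

text \<open>The signed position of mass \<open>j\<close> along its rod, measured from the center of
  mass of its dumbbell.\<close>

definition rod_offset :: "(nat \<Rightarrow> nat \<Rightarrow> real) \<Rightarrow> (nat \<Rightarrow> real) \<Rightarrow> nat \<Rightarrow> nat \<Rightarrow> real" where
  "rod_offset x l i j = (-1) ^ j * x i (3 - j) * l i"

definition colinear_offset :: "(nat \<Rightarrow> nat \<Rightarrow> real) \<Rightarrow> (nat \<Rightarrow> real) \<Rightarrow> nat \<Rightarrow> nat \<Rightarrow> real" where
  "colinear_offset x l u v = rod_offset x l 2 v - rod_offset x l 1 u"

text \<open>The radial equation is linear in \<open>L^2\<close>; this is its solution at radius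
  \<open>r\<close> with both angles zero.\<close>

definition ang_mom_sq ::
  "(nat \<Rightarrow> real) \<Rightarrow> (nat \<Rightarrow> nat \<Rightarrow> real) \<Rightarrow> (nat \<Rightarrow> real) \<Rightarrow> real \<Rightarrow> real" where
  "ang_mom_sq M x l r = (\<Sum>u\<in>{1,2}. \<Sum>v\<in>{1,2}. x 1 u * x 2 v *
     ang_mom_term (inertia_const M x l 1 + inertia_const M x l 2) (colinear_offset x l u v) r)"

lemma mass_dist_eq:
  assumes "M 1 + M 2 = 1"
  shows "mass_dist M x l u v q =
    sqrt ((fst q + rod_offset x l 2 v * cos (snd (snd q)) - rod_offset x l 1 u * cos (fst (snd q)))\<^sup>2
          + (rod_offset x l 2 v * sin (snd (snd q)) - rod_offset x l 1 u * sin (fst (snd q)))\<^sup>2)"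
proof -
  obtain r s t where q: "q = (r, s, t)" by (cases q) auto
  \<comment> \<open>The centers of mass sit at \<open>- M 2 * r\<close> and \<open>M 1 * r\<close>,
    hence exactly \<open>r\<close> apart.\<close>
  have "M 1 * r + M 2 * r = r" using assms by (metis distrib_right mult_1)
  then have along: "r + rod_offset x l 2 v * cos t - rod_offset x l 1 u * cos s =
      (M 1 * r + rod_offset x l 2 v * cos t) - (- M 2 * r + rod_offset x l 1 u * cos s)"
    by linarith
  have "mass_pos M x l 1 u r s = (- M 2 * r + rod_offset x l 1 u * cos s, rod_offset x l 1 u * sin s)"
    "mass_pos M x l 2 v r t = (M 1 * r + rod_offset x l 2 v * cos t, rod_offset x l 2 v * sin t)"
    by (simp_all add: mass_pos_def rod_offset_def)
  then have "mass_dist M x l u v q =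
      dist (M 1 * r + rod_offset x l 2 v * cos t, rod_offset x l 2 v * sin t)
           (- M 2 * r + rod_offset x l 1 u * cos s, rod_offset x l 1 u * sin s)"
    by (simp only: q mass_dist_def prod.case dist_commute)
  then show ?thesis
    by (simp only: dist_Pair_Pair dist_real_def power2_abs q fst_conv snd_conv along)
qed

lemma mass_dist_colinear:
  assumes "M 1 + M 2 = 1" "0 < r + colinear_offset x l u v"
  shows "mass_dist M x l u v (r, 0, 0) = r + colinear_offset x l u v"
  using assms by (simp add: mass_dist_eq colinear_offset_def)

lemma has_derivative_mass_dist_colinear:
  assumes "M 1 + M 2 = 1" "0 < r + colinear_offset x l u v"
  shows "(mass_dist M x l u v has_derivative fst) (at (r, 0, 0))"
  using has_derivative_planar_dist_at_colinear[of r "rod_offset x l 2 v" "rod_offset x l 1 u"]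
    assms(2)
  unfolding mass_dist_eq[OF assms(1), abs_def] by (simp add: colinear_offset_def)

text \<open>Every distance has derivative \<open>fst\<close>, so the gradient is purely radial. It
  is factored so that a positive prefactor multiplies the residual of the radial equation.\<close>

lemma has_derivative_amended_potential_colinear:
  assumes "M 1 + M 2 = 1" and "0 < r"
    and B: "0 \<le> inertia_const M x l 1 + inertia_const M x l 2"
    and pos: "\<And>u v. u \<in> {1,2} \<Longrightarrow> v \<in> {1,2} \<Longrightarrow> 0 < r + colinear_offset x l u v"
  shows "(amended_potential M x l L has_derivative
    (\<lambda>h. r / (r\<^sup>2 + inertia_const M x l 1 + inertia_const M x l 2)\<^sup>2 * (ang_mom_sq M x l r - L\<^sup>2) * fst h))
    (at (r, 0, 0))"
proof -
  let ?a = "colinear_offset x l"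
  define B where "B = inertia_const M x l 1 + inertia_const M x l 2"
  have B0: "0 < r\<^sup>2 + B" using B \<open>0 < r\<close> by (simp add: B_def add_pos_nonneg)
  have centrifugal: "((\<lambda>q :: real \<times> real \<times> real. L\<^sup>2 / (2 * ((fst q)\<^sup>2 + B))) has_derivative
      (\<lambda>h. - (L\<^sup>2 * r / (r\<^sup>2 + B)\<^sup>2) * fst h)) (at (r, 0, 0))"
  proof -
    let ?g = "\<lambda>q :: real \<times> real \<times> real. 2 * ((fst q)\<^sup>2 + B)"
    have g: "(?g has_derivative (\<lambda>h. 4 * r * fst h)) (at (r, 0, 0))"
      by (rule has_derivative_eq_rhs) (auto intro!: derivative_eq_intros simp: fun_eq_iff)
    have "((\<lambda>t. L\<^sup>2 / t) has_real_derivative - (L\<^sup>2 / (2 * (r\<^sup>2 + B))\<^sup>2)) (at (?g (r, 0, 0)))"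
      using B0 by (auto intro!: derivative_eq_intros simp: power2_eq_square)
    from DERIV_compose_FDERIV[where g = ?g and x = "(r, 0, 0)", OF this g] show ?thesis
      by (rule has_derivative_eq_rhs) (simp only: fun_eq_iff power_mult_distrib, simp)
  qed
  have "((\<lambda>q. x 1 u * x 2 v / mass_dist M x l u v q) has_derivative
      (\<lambda>h. - (x 1 u * x 2 v / (r + ?a u v)\<^sup>2) * fst h)) (at (r, 0, 0))"
    if uv: "u \<in> {1,2}" "v \<in> {1,2}" for u v
  proof -
    have d: "mass_dist M x l u v (r, 0, 0) = r + ?a u v"
      by (rule mass_dist_colinear[OF assms(1) pos[OF uv]])
    have "((\<lambda>t. x 1 u * x 2 v / t) has_real_derivative - (x 1 u * x 2 v / (r + ?a u v)\<^sup>2))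
        (at (mass_dist M x l u v (r, 0, 0)))"
      unfolding d using pos[OF uv] by (auto intro!: derivative_eq_intros simp: power2_eq_square)
    from DERIV_compose_FDERIV[where g = "mass_dist M x l u v" and x = "(r, 0, 0)",
        OF this has_derivative_mass_dist_colinear[OF assms(1) pos[OF uv]]]
    show ?thesis by (rule has_derivative_eq_rhs) (simp add: fun_eq_iff)
  qed
  then have "(amended_potential M x l L has_derivative
      (\<lambda>h. - (L\<^sup>2 * r / (r\<^sup>2 + B)\<^sup>2) * fst h -
        (\<Sum>u\<in>{1,2}. \<Sum>v\<in>{1,2}. - (x 1 u * x 2 v / (r + ?a u v)\<^sup>2) * fst h))) (at (r, 0, 0))"
    unfolding amended_potential_def add.assoc B_def[symmetric]
    by (intro has_derivative_diff centrifugal has_derivative_sum) auto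
  moreover have "- (L\<^sup>2 * r / (r\<^sup>2 + B)\<^sup>2) * h -
        (\<Sum>u\<in>{1,2}. \<Sum>v\<in>{1,2}. - (x 1 u * x 2 v / (r + ?a u v)\<^sup>2) * h)
      = r / (r\<^sup>2 + B)\<^sup>2 * (ang_mom_sq M x l r - L\<^sup>2) * h" for h
  proof -
    \<comment> \<open>The prefactor cancels the centrifugal part of each
      \<open>ang_mom_term\<close>, leaving the plain attractions.\<close>
    have "r / (r\<^sup>2 + B)\<^sup>2 * ang_mom_sq M x l r
        = (\<Sum>u\<in>{1,2}. \<Sum>v\<in>{1,2}. x 1 u * x 2 v / (r + ?a u v)\<^sup>2)"
      unfolding ang_mom_sq_def B_def[symmetric] sum_distrib_left ang_mom_term_def
      using B0 \<open>0 < r\<close> by (intro sum.cong refl) simp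
    moreover have "r / (r\<^sup>2 + B)\<^sup>2 * (ang_mom_sq M x l r - L\<^sup>2) * h
        = r / (r\<^sup>2 + B)\<^sup>2 * ang_mom_sq M x l r * h - L\<^sup>2 * r / (r\<^sup>2 + B)\<^sup>2 * h"
      by (simp add: right_diff_distrib left_diff_distrib)
    ultimately show ?thesis
      by (simp only: sum_distrib_right sum_negf minus_mult_left) simp
  qed
  ultimately show ?thesis by (simp add: B_def add.assoc)
qed

text \<open>Equality holds for the inner pair, mass 2 of dumbbell 1 and mass 1 of dumbbell 2. Beyond
  the collision radius all four distances are therefore positive.\<close>

lemma colinear_offset_bound:
  assumes "nontrivial_dumbbells M x l" "u \<in> {1,2}" "v \<in> {1,2}"
  shows "- (x 1 1 * l 1 + x 2 2 * l 2) \<le> colinear_offset x l u v"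
proof -
  have "0 < x i j * l i" if "i \<in> {1,2}" "j \<in> {1,2}" for i j
    using assms(1) that by (auto simp: nontrivial_dumbbells_def)
  from this[of 1 1] this[of 1 2] this[of 2 1] this[of 2 2] show ?thesis
    using assms(2,3) by (auto simp: colinear_offset_def rod_offset_def)
qed

lemma nontrivial_dumbbells_bound_pos:
  assumes "nontrivial_dumbbells M x l"
  shows "0 < x 1 1 * l 1 + x 2 2 * l 2"
  using assms by (auto simp: nontrivial_dumbbells_def intro!: add_pos_pos)

lemma nontrivial_dumbbells_inertia_pos:
  assumes "nontrivial_dumbbells M x l"
  shows "0 < inertia_const M x l 1 + inertia_const M x l 2"
  using assms by (auto simp: nontrivial_dumbbells_def inertia_const_def intro!: add_pos_pos)

lemma colinear_nonoverlapped_RE_eq: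
  assumes "nontrivial_dumbbells M x l"
  shows "colinear_nonoverlapped_RE M x l L =
    (\<lambda>r. (r, 0, 0)) ` {r. x 1 1 * l 1 + x 2 2 * l 2 < r \<and> ang_mom_sq M x l r = L\<^sup>2}"
proof -
  let ?m = "x 1 1 * l 1 + x 2 2 * l 2"
  have M: "M 1 + M 2 = 1" using assms by (simp add: nontrivial_dumbbells_def)
  have "relative_equilibrium M x l L (r, 0, 0) \<longleftrightarrow> ang_mom_sq M x l r = L\<^sup>2" if "?m < r" for r
  proof -
    have "0 < r" using nontrivial_dumbbells_bound_pos[OF assms] that by simp
    have pos: "0 < r + colinear_offset x l u v" if "u \<in> {1,2}" "v \<in> {1,2}" for u v
      using colinear_offset_bound[OF assms that] \<open>?m < r\<close> by linarith
    define D where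
      "D = r / (r\<^sup>2 + inertia_const M x l 1 + inertia_const M x l 2)\<^sup>2 * (ang_mom_sq M x l r - L\<^sup>2)"
    have deriv: "(amended_potential M x l L has_derivative (\<lambda>h. D * fst h)) (at (r, 0, 0))"
      unfolding D_def
      using nontrivial_dumbbells_inertia_pos[OF assms]
      by (intro has_derivative_amended_potential_colinear M \<open>0 < r\<close> pos) auto
    have "(amended_potential M x l L has_derivative (\<lambda>_. 0)) (at (r, 0, 0)) \<longleftrightarrow> D = 0"
    proof
      assume "(amended_potential M x l L has_derivative (\<lambda>_. 0)) (at (r, 0, 0))"
      \<comment> \<open>Evaluation in the radial direction isolates \<open>D\<close>.\<close>
      from fun_cong[OF has_derivative_unique[OF this deriv], of "(1, 0, 0)"] show "D = 0" by simp
    qed (use deriv in simp)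
    also have "D = 0 \<longleftrightarrow> ang_mom_sq M x l r = L\<^sup>2"
      using \<open>0 < r\<close> nontrivial_dumbbells_inertia_pos[OF assms]
        add_nonneg_pos[OF zero_le_power2 nontrivial_dumbbells_inertia_pos[OF assms], of r]
      unfolding D_def by (auto simp: add.assoc)
    finally have critical: "(amended_potential M x l L has_derivative (\<lambda>_. 0)) (at (r, 0, 0))
        \<longleftrightarrow> ang_mom_sq M x l r = L\<^sup>2" .
    have "mass_dist M x l u v (r, 0, 0) \<noteq> 0" if "u \<in> {1,2}" "v \<in> {1,2}" for u v
      using mass_dist_colinear[OF M pos[OF that]] pos[OF that] by linarith
    then show ?thesis
      using \<open>0 < r\<close> critical unfolding relative_equilibrium_def fst_conv by blast
  qed
  then show ?thesis by (auto simp: colinear_nonoverlapped_RE_def)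
qed

section \<open>The shape of \<open>L^2\<close> as a function of the radius\<close>

lemma ang_mom_sq_U_shaped:
  fixes M l :: "nat \<Rightarrow> real" and x :: "nat \<Rightarrow> nat \<Rightarrow> real"
  assumes nt: "nontrivial_dumbbells M x l"
  defines "m \<equiv> x 1 1 * l 1 + x 2 2 * l 2"
  obtains c where "m < c" "strict_antimono_on {m<..c} (ang_mom_sq M x l)"
    "strict_mono_on {c..} (ang_mom_sq M x l)" "continuous_on {m<..} (ang_mom_sq M x l)"
    "filterlim (ang_mom_sq M x l) at_top (at_right m)" "filterlim (ang_mom_sq M x l) at_top at_top"
proof -
  let ?I = "{1, 2 :: nat}"
  let ?a = "colinear_offset x l"
  define B where "B = inertia_const M x l 1 + inertia_const M x l 2"
  have B: "0 < B" using nontrivial_dumbbells_inertia_pos[OF nt] by (simp add: B_def)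
  have m: "0 < m" using nontrivial_dumbbells_bound_pos[OF nt] by (simp add: m_def)
  have pos: "0 < r" "0 < r + ?a u v" if "m < r" "u \<in> ?I" "v \<in> ?I" for r u v
    using that m colinear_offset_bound[OF nt, of u v] unfolding m_def by linarith+
  have w: "0 < x 1 u * x 2 v" if "u \<in> ?I" "v \<in> ?I" for u v
    using nt that by (auto simp: nontrivial_dumbbells_def)
  have F: "ang_mom_sq M x l r = (\<Sum>u\<in>?I. \<Sum>v\<in>?I. x 1 u * x 2 v * ang_mom_term B (?a u v) r)" for r
    by (simp add: ang_mom_sq_def B_def)
  define F' where "F' r = (\<Sum>u\<in>?I. \<Sum>v\<in>?I. x 1 u * x 2 v * ang_mom_term_deriv B (?a u v) r)" for r
  have deriv: "(ang_mom_sq M x l has_real_derivative F' r) (at r)" if "m < r" for r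
    unfolding F[THEN ext] F'_def using pos that
    by (intro DERIV_sum DERIV_cmult DERIV_ang_mom_term) auto
  have mono: "F' r < F' r'" if "m < r" "r < r'" for r r'
    unfolding F'_def using pos that B w
    by (intro sum_strict_mono mult_strict_left_mono ang_mom_term_deriv_strict_mono) auto
  \<comment> \<open>The inner pair collides exactly at \<open>m\<close>. Since all terms are
    nonnegative, its term alone forces divergence at both ends.\<close>
  have a21: "?a 2 1 = - m" by (simp add: colinear_offset_def rod_offset_def m_def)
  have lower: "x 1 2 * x 2 1 * ang_mom_term B (?a 2 1) r \<le> ang_mom_sq M x l r" if "m < r" for r
  proof -
    have "0 \<le> x 1 u * x 2 v * ang_mom_term B (?a u v) r" if "u \<in> ?I" "v \<in> ?I" for u v
      using w[OF that] pos(1)[OF \<open>m < r\<close> that]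
      by (intro mult_nonneg_nonneg[OF less_imp_le]) (auto simp: ang_mom_term_def)
    from this[of 1 1] this[of 1 2] this[of 2 2] show ?thesis by (simp add: F)
  qed
  have w21: "0 < x 1 2 * x 2 1" using w by simp
  have left: "filterlim (ang_mom_sq M x l) at_top (at_right m)"
  proof (rule filterlim_at_top_mono)
    show "filterlim (\<lambda>r. x 1 2 * x 2 1 * ang_mom_term B (?a 2 1) r) at_top (at_right m)"
      using ang_mom_term_at_singularity[OF B, of "- m"] m a21 w21
      by (intro filterlim_tendsto_pos_mult_at_top[OF tendsto_const]) auto
    show "eventually (\<lambda>r. x 1 2 * x 2 1 * ang_mom_term B (?a 2 1) r \<le> ang_mom_sq M x l r) (at_right m)"
      using lower by (auto simp: eventually_at_right_field intro!: exI[of _ "m + 1"])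
  qed
  have right: "filterlim (ang_mom_sq M x l) at_top at_top"
  proof (rule filterlim_at_top_mono)
    show "filterlim (\<lambda>r. x 1 2 * x 2 1 * ang_mom_term B (?a 2 1) r) at_top at_top"
      by (intro filterlim_tendsto_pos_mult_at_top[OF tendsto_const w21] ang_mom_term_at_top)
    show "eventually (\<lambda>r. x 1 2 * x 2 1 * ang_mom_term B (?a 2 1) r \<le> ang_mom_sq M x l r) at_top"
      using eventually_gt_at_top[of m] by eventually_elim (rule lower)
  qed
  have "continuous_on {m<..} (ang_mom_sq M x l)"
    using deriv by (intro DERIV_continuous_on[where D = F']) (auto intro: has_field_derivative_at_within)
  then show thesis
    using U_shaped_of_deriv_strict_mono[OF deriv mono left right] left right that by blast
qed

text \<open>Applied at the minimum, this makes the bifurcation value of \<open>L\<close> strictly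
  positive.\<close>

lemma ang_mom_sq_pos:
  assumes "nontrivial_dumbbells M x l" "x 1 1 * l 1 + x 2 2 * l 2 < r"
  shows "0 < ang_mom_sq M x l r"
  unfolding ang_mom_sq_def
proof (intro sum_pos)
  fix u v :: nat assume uv: "u \<in> {1,2}" "v \<in> {1,2}"
  have "0 < r" "0 < r + colinear_offset x l u v"
    using assms(2) nontrivial_dumbbells_bound_pos[OF assms(1)] colinear_offset_bound[OF assms(1) uv]
    by linarith+
  moreover have "0 < x 1 u * x 2 v"
    using assms(1) uv by (auto simp: nontrivial_dumbbells_def)
  moreover have "0 < r\<^sup>2 + (inertia_const M x l 1 + inertia_const M x l 2)"
    using nontrivial_dumbbells_inertia_pos[OF assms(1)] by (simp add: add_nonneg_pos)
  ultimately show "0 < x 1 u * x 2 v * ang_mom_term (inertia_const M x l 1 + inertia_const M x l 2)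
      (colinear_offset x l u v) r"
    by (simp add: ang_mom_term_def)
qed auto

section \<open>Bifurcation at the minimum of \<open>L^2\<close>\<close>

theorem theorem5p3p1:
  fixes M l :: "nat \<Rightarrow> real" and x :: "nat \<Rightarrow> nat \<Rightarrow> real"
  assumes "nontrivial_dumbbells M x l"
  shows "(\<exists>L0>0. \<forall>L. 0 \<le> L \<and> L < L0 \<longrightarrow> colinear_nonoverlapped_RE M x l L = {}) \<and>
    (\<exists>Lb rb. 0 < Lb \<and> x 1 1 * l 1 + x 2 2 * l 2 < rb \<and>
       two_RE_bifurcate (colinear_nonoverlapped_RE M x l) Lb rb \<and>
       (\<forall>L>Lb. card (colinear_nonoverlapped_RE M x l L) = 2))"
proof -
  let ?m = "x 1 1 * l 1 + x 2 2 * l 2"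
  let ?F = "ang_mom_sq M x l"
  let ?S = "colinear_nonoverlapped_RE M x l"
  let ?P = "\<lambda>r :: real. (r, 0 :: real, 0 :: real)"
  obtain c where c: "?m < c" and anti: "strict_antimono_on {?m<..c} ?F" and mono: "strict_mono_on {c..} ?F"
    and cont: "continuous_on {?m<..} ?F" and left: "filterlim ?F at_top (at_right ?m)"
    and right: "filterlim ?F at_top at_top"
    using ang_mom_sq_U_shaped[OF assms] .
  obtain g1 g2 where g1: "continuous_on {?F c<..} g1" "(g1 \<longlongrightarrow> c) (at_right (?F c))"
    and g2: "continuous_on {?F c<..} g2" "(g2 \<longlongrightarrow> c) (at_right (?F c))"
    and g: "\<And>y. ?F c < y \<Longrightarrow> g1 y < g2 y \<and> {r. ?m < r \<and> ?F r = y} = {g1 y, g2 y}"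
    by (rule U_shaped_inverse_branches[OF c anti mono cont left right]) blast
  \<comment> \<open>The same value also serves as the threshold \<open>L0\<close> below which no
    equilibria exist.\<close>
  define Lb where "Lb = sqrt (?F c)"
  have Lb: "0 < Lb" "Lb\<^sup>2 = ?F c"
    using ang_mom_sq_pos[OF assms c] by (auto simp: Lb_def)
  have min: "?F c \<le> ?F r" if "?m < r" for r
    using that c anti mono by (cases r c rule: linorder_cases) (force simp: monotone_on_def)+
  have RE: "?S L = ?P ` {r. ?m < r \<and> ?F r = L\<^sup>2}" for L
    by (rule colinear_nonoverlapped_RE_eq[OF assms])
  have above: "?F c < L\<^sup>2" if "Lb < L" for L
    using that Lb by (metis less_imp_le power_strict_mono zero_less_numeral)
  have two: "?S L = {?P (g1 (L\<^sup>2)), ?P (g2 (L\<^sup>2))}" "g1 (L\<^sup>2) < g2 (L\<^sup>2)" if "Lb < L" for L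
    using g[OF above[OF that]] by (auto simp: RE)
  have "?S L = {}" if "0 \<le> L" "L < Lb" for L
  proof -
    have "L\<^sup>2 < ?F c" using that Lb by (metis power_strict_mono zero_less_numeral)
    then show ?thesis using min by (force simp: RE)
  qed
  moreover have "card (?S L) = 2" if "Lb < L" for L
    using two[OF that] by simp
  moreover have "two_RE_bifurcate ?S Lb c"
    unfolding two_RE_bifurcate_def
  \<comment> \<open>The witnesses \<open>?P c\<close>, \<open>?P (g1 (L^2))\<close> and
    \<open>?P (g2 (L^2))\<close> are fixed by unification with the facts shown below.\<close>
  proof (intro exI conjI allI impI)
    show "?P c \<in> ?S Lb" using c Lb by (auto simp: RE)
    \<comment> \<open>Squaring approaches \<open>?F c\<close> strictly from above, so the one-sided
      limits of the inverse branches carry over from \<open>L^2\<close> to \<open>L\<close>.\<close>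
    have sq: "filterlim (\<lambda>L. L\<^sup>2) (at_right (?F c)) (at_right Lb)"
      unfolding filterlim_at
    proof
      show "eventually (\<lambda>L. L\<^sup>2 \<in> {?F c<..} \<and> L\<^sup>2 \<noteq> ?F c) (at_right Lb)"
        using eventually_at_right_less[of Lb] by eventually_elim (use above in force)
      show "((\<lambda>L. L\<^sup>2) \<longlongrightarrow> ?F c) (at_right Lb)"
        using Lb(2) by (auto intro!: tendsto_eq_intros)
    qed
    have lim: "((\<lambda>L. ?P (g (L\<^sup>2))) \<longlongrightarrow> ?P c) (at_right Lb)" if "(g \<longlongrightarrow> c) (at_right (?F c))" for g
      by (intro tendsto_intros filterlim_compose[OF that sq])
    have cont: "continuous_on {Lb<..} (\<lambda>L. ?P (g (L\<^sup>2)))" if "continuous_on {?F c<..} g" for g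
      using above
      by (intro continuous_intros continuous_on_compose2[OF that]) auto
    show "((\<lambda>L. ?P (g1 (L\<^sup>2))) \<longlongrightarrow> ?P c) (at_right Lb)" "((\<lambda>L. ?P (g2 (L\<^sup>2))) \<longlongrightarrow> ?P c) (at_right Lb)"
      "continuous_on {Lb<..} (\<lambda>L. ?P (g1 (L\<^sup>2)))" "continuous_on {Lb<..} (\<lambda>L. ?P (g2 (L\<^sup>2)))"
      using g1 g2 lim cont by blast+
  qed (use two less_imp_neq[OF two(2)] in auto)
  ultimately show ?thesis using Lb(1) c by blast
qed

end
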